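(* Let $r,\chi$ be integers with $2\leq\chi\leq r+1$, and let $b$ be an integer with $0\leq b<\chi$ such that $\chi-1$ divides $r-b$ and $r-b\geq\chi-1$. Then \[\left\lceil\frac{r\chi}{\chi-1}\right\rceil\leq n(r|\chi)\leq \min\left\{2\left\lfloor\frac{r\chi}{\chi-1}\right\rfloor,\ \frac{r-b}{\chi-1}\,\chi\,(b+1)\right\}.\]
   Context: An $(r|\chi)$-graph is a simple finite $r$-regular graph with chromatic number $\chi$. $n(r|\chi)$ is the minimum order of an $(r|\chi)$-graph. *)

theory Defs
  imports Complex_Main "Graph_Theory.Pair_Digraph"
begin

text \<open>
  Finite simple graphs are the symmetric loop-free finite digraphs of the locale
  \<^locale>\<open>pair_graph\<close>: an edge \<open>uv\<close> is the pair of arcs \<open>(u, v)\<close>, \<open>(v, u)\<close>. Hence the degree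
  of a vertex is its out-degree (equivalently its in-degree), not the sum of the two.
\<close>

definition regular_graph :: "nat \<Rightarrow> 'a pair_pre_digraph \<Rightarrow> bool" where
  "regular_graph r G \<longleftrightarrow> pair_graph G \<and> (\<forall>v\<in>pverts G. out_degree (with_proj G) v = r)"

definition proper_coloring :: "'a pair_pre_digraph \<Rightarrow> nat \<Rightarrow> ('a \<Rightarrow> nat) \<Rightarrow> bool" where
  "proper_coloring G k c \<longleftrightarrow>
     (\<forall>v\<in>pverts G. c v < k) \<and> (\<forall>(u, v)\<in>parcs G. c u \<noteq> c v)"

definition chromatic_number :: "'a pair_pre_digraph \<Rightarrow> nat" where
  "chromatic_number G = (LEAST k. \<exists>c. proper_coloring G k c)"

definition rchi_graph :: "nat \<Rightarrow> nat \<Rightarrow> 'a pair_pre_digraph \<Rightarrow> bool" where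
  "rchi_graph r k G \<longleftrightarrow> regular_graph r G \<and> chromatic_number G = k"

text \<open>
  Vertices are taken from \<^typ>\<open>nat\<close> without loss of generality, by \<open>rchi_graph_on_nat\<close> below.
  If there were no such graph, the value would be \<open>Inf {} = 0\<close>; so any positive lower bound on
  \<open>min_order\<close> includes the assertion that the minimum exists.
\<close>

definition min_order :: "nat \<Rightarrow> nat \<Rightarrow> nat" where
  "min_order r k = Inf {card (pverts G) | G :: nat pair_pre_digraph. rchi_graph r k G}"

lemma rchi_graph_on_nat:
  fixes G :: "'a pair_pre_digraph"
  assumes "rchi_graph r k G"
  shows "\<exists>H :: nat pair_pre_digraph. rchi_graph r k H \<and> card (pverts H) = card (pverts G)"
proof -
  interpret pair_graph G
    using assms by (simp add: rchi_graph_def regular_graph_def)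
  obtain f :: "'a \<Rightarrow> nat" where f: "inj_on f (pverts G)"
    using finite_imp_inj_to_nat_seg[OF pair_finite_verts] by blast
  define H where "H = \<lparr> pverts = f ` pverts G, parcs = map_prod f f ` parcs G \<rparr>"
  have ends: "u \<in> pverts G \<and> v \<in> pverts G" if "(u, v) \<in> parcs G" for u v
    using that in_arcsD1 in_arcsD2 by blast
  have sym: "(v, u) \<in> parcs G" if "(u, v) \<in> parcs G" for u v
    using pair_sym_arcs that by (auto simp: symmetric_def arcs_ends_def arc_to_ends_def
        with_proj_def dest: symD)
  have H: "pair_graph H"
  proof
    show "symmetric (with_proj H)"
      using sym by (force simp: H_def symmetric_def arcs_ends_def arc_to_ends_def with_proj_def
          intro!: symI)
  qed (use ends f pair_no_loops in \<open>force simp: H_def dest: inj_onD\<close>)+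
  have deg: "out_degree (with_proj H) (f v) = out_degree (with_proj G) v" if v: "v \<in> pverts G" for v
  proof -
    have "out_arcs (with_proj H) (f v) = map_prod f f ` out_arcs (with_proj G) v"
      using v ends f by (fastforce simp: out_arcs_def with_proj_def H_def dest: inj_onD)
    moreover have "inj_on (map_prod f f) (out_arcs (with_proj G) v)"
      using ends f by (fastforce simp: out_arcs_def with_proj_def inj_on_def)
    ultimately show ?thesis
      by (simp add: out_degree_def card_image)
  qed
  have "(\<exists>c. proper_coloring H m c) \<longleftrightarrow> (\<exists>c. proper_coloring G m c)" for m
  proof
    assume "\<exists>c. proper_coloring H m c"
    then obtain c where "proper_coloring H m c" ..
    then have "proper_coloring G m (c \<circ> f)"
      by (force simp: proper_coloring_def H_def)
    then show "\<exists>c. proper_coloring G m c" by blast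
  next
    assume "\<exists>c. proper_coloring G m c"
    then obtain c where "proper_coloring G m c" ..
    then have "proper_coloring H m (c \<circ> inv_into (pverts G) f)"
      using ends f by (fastforce simp: proper_coloring_def H_def)
    then show "\<exists>c. proper_coloring H m c" by blast
  qed
  then have "chromatic_number H = chromatic_number G"
    by (simp add: chromatic_number_def)
  moreover have "regular_graph r H"
    using H deg assms by (auto simp: rchi_graph_def regular_graph_def H_def)
  moreover have "card (pverts H) = card (pverts G)"
    using f by (simp add: H_def card_image)
  ultimately show ?thesis
    using assms by (auto simp: rchi_graph_def)
qed

end

theory Submission
  imports Defs "HOL-Number_Theory.Cong"
begin

text \<open>
  Lower bound: a colour class is independent, so a vertex in it has its \<open>r\<close> neighbours
  outside it; hence each of the \<open>\<chi>\<close> classes has at most \<open>n - r\<close> vertices and \<open>n \<le> \<chi> (n - r)\<close>.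

  Upper bounds: take \<open>m \<le> \<chi>\<close> copies of the complete \<open>\<chi>\<close>-partite graph on \<open>{..<n}\<close> whose parts are
  the residue classes modulo \<open>\<chi>\<close>, and make the copies of each vertex in the first \<open>t\<close> parts
  pairwise adjacent. Rotating the \<open>\<chi>\<close>-colouring by \<open>i\<close> in copy \<open>i\<close> keeps it proper. For
  \<open>r = q (\<chi> - 1) + s\<close>, \<open>s < \<chi> - 1\<close>, the choice \<open>m = 2\<close>, \<open>n = q \<chi> + s\<close>, \<open>t = s\<close> repairs the
  degrees in the \<open>s\<close> parts that are one vertex too large and gives the first bound; for
  \<open>r = a (\<chi> - 1) + b\<close>, the choice \<open>m = b + 1\<close>, \<open>n = a \<chi>\<close>, \<open>t = \<chi>\<close> gives the second.
\<close>

section \<open>Degrees, colourings and the lower bound\<close>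

lemma out_degree_with_proj:
  "out_degree (with_proj G) v = card {w. (v, w) \<in> parcs G}"
proof -
  have "out_arcs (with_proj G) v = Pair v ` {w. (v, w) \<in> parcs G}"
    by (auto simp: out_arcs_def with_proj_def)
  then show ?thesis
    by (simp add: out_degree_def card_image inj_on_def)
qed

text \<open>Makes the \<open>LEAST\<close> meaningful: an injective numbering of the finitely many
  vertices is a proper colouring, since there are no loops.\<close>

lemma proper_coloring_chromatic_number:
  assumes "pair_graph G"
  shows "\<exists>c. proper_coloring G (chromatic_number G) c"
proof -
  interpret pair_graph G by fact
  obtain f :: "'a \<Rightarrow> nat" and k where f: "f ` pverts G = {i. i < k}" "inj_on f (pverts G)"
    using finite_imp_inj_to_nat_seg[OF pair_finite_verts] by blast
  have "f u \<noteq> f v" if "(u, v) \<in> parcs G" for u v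
    using that f(2) in_arcsD1[OF that] in_arcsD2[OF that] pair_no_loops[OF that]
    by (auto dest: inj_onD)
  then have "proper_coloring G k f"
    using f(1) by (auto simp: proper_coloring_def)
  then show ?thesis
    unfolding chromatic_number_def by (intro LeastI[of "\<lambda>k. \<exists>c. proper_coloring G k c" k] exI)
qed

lemma order_rchi_graph_ge:
  assumes G: "rchi_graph r k G" and k: "0 < k"
  shows "r * k \<le> card (pverts G) * (k - 1)"
proof -
  have reg: "card {w. (v, w) \<in> parcs G} = r" if "v \<in> pverts G" for v
    using G that by (auto simp: rchi_graph_def regular_graph_def out_degree_with_proj)
  have "pair_graph G" and chi: "chromatic_number G = k"
    using G by (auto simp: rchi_graph_def regular_graph_def)
  then interpret pair_graph G by simp
  define n where "n = card (pverts G)"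
  obtain c where c: "proper_coloring G k c"
    using proper_coloring_chromatic_number[OF \<open>pair_graph G\<close>] chi by auto
  have class_le: "card {v \<in> pverts G. c v = j} + r \<le> n" if v: "v \<in> pverts G" "c v = j" for v j
  proof -
    let ?A = "{v \<in> pverts G. c v = j}" and ?N = "{w. (v, w) \<in> parcs G}"
    have N: "?N \<subseteq> pverts G"
      using in_arcsD2 by blast
    have "?A \<inter> ?N = {}"
      using c v by (auto simp: proper_coloring_def)
    then have "card ?A + card ?N = card (?A \<union> ?N)"
      using finite_subset[OF N] by (simp add: card_Un_disjoint)
    also have "\<dots> \<le> n"
      unfolding n_def using N by (intro card_mono) auto
    finally show ?thesis
      using reg[OF v(1)] by simp
  qed
  \<comment> \<open>The empty graph has chromatic number 0, so \<open>0 < k\<close> provides a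
    vertex. Its class yields \<open>r \<le> n\<close>, which keeps \<open>n - r\<close> from being
    truncated.\<close>
  have "pverts G \<noteq> {}"
  proof
    assume "pverts G = {}"
    then have "parcs G = {}"
      using in_arcsD1 by fastforce
    with \<open>pverts G = {}\<close> have "proper_coloring G 0 c"
      by (simp add: proper_coloring_def)
    then have "chromatic_number G \<le> 0"
      unfolding chromatic_number_def by (intro Least_le) blast
    with chi k show False by simp
  qed
  then obtain v where "v \<in> pverts G" by blast
  from class_le[OF this refl] have "r \<le> n" by simp
  have bound: "card {v \<in> pverts G. c v = j} \<le> n - r" for j
  proof (cases "{v \<in> pverts G. c v = j} = {}")
    case True
    then show ?thesis by (metis card.empty le0)
  next
    case False
    then obtain v where "v \<in> pverts G" "c v = j" by blast
    then show ?thesis using class_le[of v j] by linarith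
  qed
  have "pverts G = (\<Union>j<k. {v \<in> pverts G. c v = j})"
    using c by (auto simp: proper_coloring_def)
  then have "n = card (\<Union>j<k. {v \<in> pverts G. c v = j})"
    unfolding n_def by (rule arg_cong)
  also have "\<dots> \<le> (\<Sum>j<k. card {v \<in> pverts G. c v = j})"
    by (rule card_UN_le) simp
  also have "\<dots> \<le> k * (n - r)"
    using sum_bounded_above[of "{..<k}" "\<lambda>j. card {v \<in> pverts G. c v = j}" "n - r"] bound by simp
  finally have "n + k * r \<le> k * n"
    using \<open>r \<le> n\<close> by (simp add: diff_mult_distrib2 le_diff_conv2)
  then show ?thesis
    using k by (cases k) (auto simp: n_def algebra_simps)
qed

section \<open>Linked copies of balanced complete multipartite graphs\<close>

lemma card_residue_class_lessThan:
  fixes q k s j :: nat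
  assumes "s < k" "j < k"
  shows "card {v. v < q * k + s \<and> v mod k = j} = q + of_bool (j < s)"
proof -
  \<comment> \<open>The members of class \<open>j\<close> are the \<open>i * k + j\<close>: those
    with \<open>i < q\<close> always fit, and \<open>i = q\<close> fits just when
    \<open>j < s\<close>.\<close>
  have lt: "i * k + j < q * k + s \<longleftrightarrow> i < q + of_bool (j < s)" for i
  proof (cases i q rule: linorder_cases)
    case less
    then have "Suc i * k \<le> q * k" by (intro mult_le_mono1) simp
    then have "i * k + j < q * k + s" using assms by simp
    with less show ?thesis by simp
  next
    case greater
    then have "Suc q * k \<le> i * k" by (intro mult_le_mono1) simp
    then have "\<not> i * k + j < q * k + s" using assms by simp
    with greater show ?thesis by simp
  next
    case equal
    then show ?thesis by simp
  qed
  have "{v. v < q * k + s \<and> v mod k = j} = (\<lambda>i. i * k + j) ` {..<q + of_bool (j < s)}"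
  proof (intro subset_antisym subsetI)
    fix v assume v: "v \<in> {v. v < q * k + s \<and> v mod k = j}"
    then have v_eq: "v = v div k * k + j"
      using div_mult_mod_eq[of v k] by (metis (mono_tags, lifting) mem_Collect_eq)
    moreover have "v < q * k + s"
      using v by blast
    ultimately have "v div k * k + j < q * k + s"
      by (rule subst)
    then have "v div k \<in> {..<q + of_bool (j < s)}"
      unfolding lt by (simp only: lessThan_iff)
    with v_eq show "v \<in> (\<lambda>i. i * k + j) ` {..<q + of_bool (j < s)}"
      by (rule image_eqI)
  next
    fix v assume "v \<in> (\<lambda>i. i * k + j) ` {..<q + of_bool (j < s)}"
    then obtain i where "v = i * k + j" "i < q + of_bool (j < s)" by blast
    then show "v \<in> {v. v < q * k + s \<and> v mod k = j}"
      using lt[of i] assms by simp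
  qed
  moreover have "inj_on (\<lambda>i. i * k + j) {..<q + of_bool (j < s)}"
    using assms by (simp add: inj_on_def)
  ultimately show ?thesis
    by (simp add: card_image)
qed

text \<open>Copy \<open>i\<close> of vertex \<open>u\<close> is \<open>(i, u)\<close>. For
  \<open>0 < k\<close> each copy is the Turan graph with \<open>n\<close> vertices and
  \<open>k\<close> parts.\<close>

definition linked_copies :: "nat \<Rightarrow> nat \<Rightarrow> nat \<Rightarrow> nat \<Rightarrow> (nat \<times> nat) pair_pre_digraph" where
  "linked_copies m n k t =
    \<lparr> pverts = {..<m} \<times> {..<n},
      parcs = {((i, u), (j, v)). i < m \<and> j < m \<and> u < n \<and> v < n \<and>
        (if i = j then u mod k \<noteq> v mod k else u = v \<and> u mod k < t)} \<rparr>"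

lemma pair_graph_linked_copies: "pair_graph (linked_copies m n k t)"
proof
  show "symmetric (with_proj (linked_copies m n k t))"
    by (auto simp: linked_copies_def symmetric_def arcs_ends_def arc_to_ends_def with_proj_def
        intro!: symI split: if_splits)
  have "parcs (linked_copies m n k t) \<subseteq> ({..<m} \<times> {..<n}) \<times> ({..<m} \<times> {..<n})"
    by (auto simp: linked_copies_def)
  then show "finite (parcs (linked_copies m n k t))"
    by (rule finite_subset) simp
qed (auto simp: linked_copies_def split: if_splits)

text \<open>Inside its copy a vertex misses exactly its own part; if it is linked, its copies form a
  clique, which adds \<open>m - 1\<close> neighbours.\<close>

lemma out_degree_linked_copies:
  assumes "s < k" "i < m" "u < q * k + s"
  shows "out_degree (with_proj (linked_copies m (q * k + s) k t)) (i, u) =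
    q * k + s - (q + of_bool (u mod k < s)) + (if u mod k < t then m - 1 else 0)"
proof -
  let ?n = "q * k + s"
  let ?C = "{v. v < ?n \<and> v mod k = u mod k}"
  let ?A = "Pair i ` ({..<?n} - ?C)"
  let ?B = "if u mod k < t then (\<lambda>j. (j, u)) ` ({..<m} - {i}) else {}"
  have "{w. ((i, u), w) \<in> parcs (linked_copies m ?n k t)} = ?A \<union> ?B"
    using assms by (auto simp: linked_copies_def split: if_splits)
  moreover have "card (?A \<union> ?B) = card ?A + card ?B"
    by (intro card_Un_disjoint) auto
  moreover have "card ?A = ?n - card ?C"
  proof -
    have "card ({..<?n} - ?C) = card {..<?n} - card ?C"
      by (intro card_Diff_subset) auto
    then show ?thesis by (simp add: card_image inj_on_def)
  qed
  moreover have "card ?B = (if u mod k < t then m - 1 else 0)"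
    using assms by (simp add: card_image inj_on_def)
  ultimately show ?thesis
    using assms by (simp add: out_degree_with_proj card_residue_class_lessThan)
qed

text \<open>\<open>m \<le> k\<close> keeps the rotations of different copies distinct modulo
  \<open>k\<close>, so \<open>k\<close> colours suffice. \<open>k \<le> n\<close> leaves a vertex of
  every part in copy 0; these form a \<open>k\<close>-clique, so fewer colours do not
  suffice.\<close>

lemma chromatic_number_linked_copies:
  assumes "0 < k" "0 < m" "m \<le> k" "k \<le> n"
  shows "chromatic_number (linked_copies m n k t) = k"
  unfolding chromatic_number_def
proof (rule Least_equality)
  have inj: "i = j" if "(u + i) mod k = (u + j) mod k" "i < m" "j < m" for u i j
  proof -
    have "[u + i = u + j] (mod k)"
      using that(1) by (simp only: cong_def)
    then have "i mod k = j mod k"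
      unfolding cong_add_lcancel_nat by (simp only: cong_def)
    moreover have "i < k" "j < k"
      using that assms by linarith+
    ultimately show ?thesis by simp
  qed
  have shift: "u mod k = v mod k" if "(u + i) mod k = (v + i) mod k" for u v i :: nat
  proof -
    have "[u + i = v + i] (mod k)"
      using that by (simp only: cong_def)
    then show ?thesis
      unfolding cong_add_rcancel_nat by (simp only: cong_def)
  qed
  show "\<exists>c. proper_coloring (linked_copies m n k t) k c"
    unfolding proper_coloring_def
  proof (intro exI[of _ "\<lambda>(i, v). (v + i) mod k"] conjI ballI, goal_cases)
    case (1 w)
    then show ?case using assms by (simp add: case_prod_unfold)
  next
    case (2 e)
    obtain i u j v where e: "e = ((i, u), (j, v))"
      by (metis surj_pair)
    with 2 have arc: "i < m" "j < m" "if i = j then u mod k \<noteq> v mod k else u = v"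
      by (auto simp: linked_copies_def split: if_splits)
    have "(u + i) mod k \<noteq> (v + j) mod k"
    proof (cases "i = j")
      case True
      with arc(3) have "u mod k \<noteq> v mod k" by simp
      with shift have "(u + i) mod k \<noteq> (v + i) mod k" by blast
      then show ?thesis unfolding True .
    next
      case False
      with arc(3) have "u = v" by simp
      have "(u + i) mod k \<noteq> (u + j) mod k"
        using inj[OF _ arc(1,2)] False by blast
      then show ?thesis unfolding \<open>u = v\<close> .
    qed
    then show ?case by (simp add: e)
  qed
next
  fix l assume "\<exists>c. proper_coloring (linked_copies m n k t) l c"
  then obtain c where c: "proper_coloring (linked_copies m n k t) l c" ..
  have "c (0, u) < l" if "u < k" for u
    using c that assms by (auto simp: proper_coloring_def linked_copies_def)
  moreover have "c (0, u) \<noteq> c (0, v)" if "u < k" "v < k" "u \<noteq> v" for u v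
  proof -
    have "((0, u), (0, v)) \<in> parcs (linked_copies m n k t)"
      using that assms by (simp add: linked_copies_def)
    then show ?thesis using c by (auto simp: proper_coloring_def)
  qed
  ultimately show "k \<le> l"
    using card_inj_on_le[of "\<lambda>u. c (0, u)" "{..<k}" "{..<l}"] by (auto simp: inj_on_def)
qed

text \<open>The degree depends only on the part \<open>j\<close> of a vertex, so regularity is one
  equation per \<open>j\<close>; \<open>0 < q\<close> makes all \<open>k\<close> parts
  nonempty.\<close>

lemma rchi_graph_linked_copies:
  assumes "0 < k" "0 < m" "m \<le> k" "s < k" "0 < q"
    and "\<And>j. j < k \<Longrightarrow>
      q * k + s - (q + of_bool (j < s)) + (if j < t then m - 1 else 0) = r"
  shows "rchi_graph r k (linked_copies m (q * k + s) k t)"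
proof -
  have "k \<le> q * k + s"
    using \<open>0 < q\<close> by (simp add: trans_le_add1)
  then have "chromatic_number (linked_copies m (q * k + s) k t) = k"
    using assms by (intro chromatic_number_linked_copies) auto
  moreover have "regular_graph r (linked_copies m (q * k + s) k t)"
    unfolding regular_graph_def
  proof (intro conjI ballI pair_graph_linked_copies)
    fix w assume "w \<in> pverts (linked_copies m (q * k + s) k t)"
    then obtain i u where "w = (i, u)" "i < m" "u < q * k + s"
      by (auto simp: linked_copies_def)
    then show "out_degree (with_proj (linked_copies m (q * k + s) k t)) w = r"
      using assms by (simp add: out_degree_linked_copies)
  qed
  ultimately show ?thesis by (simp add: rchi_graph_def)
qed

section \<open>The minimum order and the combined bounds\<close>

lemma min_order_le:
  fixes G :: "'a pair_pre_digraph"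
  assumes "rchi_graph r k G"
  shows "min_order r k \<le> card (pverts G)"
proof -
  obtain H :: "nat pair_pre_digraph" where "rchi_graph r k H" "card (pverts H) = card (pverts G)"
    using rchi_graph_on_nat[OF assms] by blast
  then have "card (pverts G) \<in> {card (pverts G) | G :: nat pair_pre_digraph. rchi_graph r k G}"
    by (intro CollectI exI[of _ H]) simp
  then show ?thesis
    unfolding min_order_def by (intro cInf_lower) simp_all
qed

text \<open>A witness of any vertex type makes the set of orders nonempty, which excludes the
  default \<open>Inf {} = 0\<close>; a nonempty set of naturals contains its infimum.\<close>

lemma min_order_attained:
  fixes G :: "'a pair_pre_digraph"
  assumes "rchi_graph r k G"
  shows "\<exists>H :: nat pair_pre_digraph. rchi_graph r k H \<and> card (pverts H) = min_order r k"
proof -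
  have "{card (pverts G) | G :: nat pair_pre_digraph. rchi_graph r k G} \<noteq> {}"
    using rchi_graph_on_nat[OF assms] by blast
  from Inf_nat_def1[OF this] show ?thesis
    unfolding min_order_def by force
qed

theorem theorem7:
  fixes r \<chi> b :: nat
  assumes "2 \<le> \<chi>" and "\<chi> \<le> r + 1"
    and "b < \<chi>"
    and "int \<chi> - 1 dvd int r - int b"
    and "int r - int b \<ge> int \<chi> - 1"
  shows "\<lceil>(real r * real \<chi>) / (real \<chi> - 1)\<rceil> \<le> int (min_order r \<chi>) \<and>
    int (min_order r \<chi>) \<le>
      min (2 * \<lfloor>(real r * real \<chi>) / (real \<chi> - 1)\<rfloor>)
          ((int r - int b) div (int \<chi> - 1) * int \<chi> * (int b + 1))"
proof -
  obtain d where chi: "\<chi> = Suc d" and d: "0 < d" "d \<le> r"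
    using assms(1,2) by (cases \<chi>) auto

  define q s where "q = r div d" and "s = r mod d"
  have r1: "r = q * d + s" and "s < d"
    using d by (simp_all add: q_def s_def)
  have "0 < q"
    using d by (simp add: q_def div_greater_zero_iff)
  \<comment> \<open>Parts \<open>j < s\<close> have \<open>q + 1\<close> vertices and degree
    \<open>r - 1\<close> within a copy, which the single link raises to \<open>r\<close>; the others
    have \<open>q\<close> vertices and degree \<open>q * d + s = r\<close>.\<close>
  have G1: "rchi_graph r \<chi> (linked_copies 2 (q * \<chi> + s) \<chi> s)"
    using \<open>s < d\<close> \<open>0 < q\<close> \<open>0 < d\<close>
    by (intro rchi_graph_linked_copies) (auto simp: chi r1)
  \<comment> \<open>Since \<open>r * \<chi> / d = r + r / d\<close>, the floor is
    \<open>r + q\<close>, the order of one copy.\<close>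
  have floor: "\<lfloor>(real r * real \<chi>) / (real \<chi> - 1)\<rfloor> = int (q * \<chi> + s)"
  proof -
    have "\<lfloor>(real r * real \<chi>) / (real \<chi> - 1)\<rfloor> = int (r * \<chi> div d)"
      using floor_divide_of_nat_eq[where ?'a = real, of "r * \<chi>" d] by (simp add: chi algebra_simps)
    also have "r * \<chi> div d = r + q"
      using d by (simp add: chi q_def)
    finally show ?thesis by (simp add: r1 chi)
  qed
  have upper1: "min_order r \<chi> \<le> 2 * (q * \<chi> + s)"
    using min_order_le[OF G1] by (simp add: linked_copies_def)

  \<comment> \<open>As \<open>r - b\<close> is at least \<open>d > 0\<close>, the quotient
    \<open>a'\<close> is positive and hence a natural number \<open>a\<close>.\<close>
  obtain a' where a': "int r - int b = int d * a'"
    using assms(4) by (auto simp: chi elim: dvdE)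
  have "0 < int d * a'"
    using assms(5) d a' by (simp add: chi)
  then have "0 < a'"
    using d by (simp add: zero_less_mult_iff)
  then obtain a where a: "a' = int a" "0 < a"
    by (metis pos_int_cases)
  have "int r = int (a * d + b)"
    using a' a by (simp add: algebra_simps)
  then have r2: "r = a * d + b"
    using of_nat_eq_iff by blast
  \<comment> \<open>Every part has \<open>a\<close> vertices, so the degree within a copy is
    \<open>a * d\<close>; linking \<open>b + 1\<close> copies adds \<open>b\<close>. The limit on
    the number of copies is \<open>b < \<chi>\<close>.\<close>
  have G2: "rchi_graph r \<chi> (linked_copies (b + 1) (a * \<chi> + 0) \<chi> \<chi>)"
    using assms(3) \<open>0 < a\<close> by (intro rchi_graph_linked_copies) (auto simp: chi r2)
  have upper2: "min_order r \<chi> \<le> a * \<chi> * (b + 1)"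
    using min_order_le[OF G2] by (simp add: linked_copies_def algebra_simps)
  have quot: "(int r - int b) div (int \<chi> - 1) = int a"
    using a a' d by (simp add: chi)

  obtain H :: "nat pair_pre_digraph" where "rchi_graph r \<chi> H" "card (pverts H) = min_order r \<chi>"
    using min_order_attained[OF G1] by blast
  then have "r * \<chi> \<le> min_order r \<chi> * d"
    using order_rchi_graph_ge[of r \<chi> H] by (simp add: chi)
  then have "real r * real \<chi> \<le> real (min_order r \<chi>) * real d"
    by (metis of_nat_le_iff of_nat_mult)
  then have lower: "\<lceil>(real r * real \<chi>) / (real \<chi> - 1)\<rceil> \<le> int (min_order r \<chi>)"
    using d by (simp add: ceiling_le_iff pos_divide_le_eq chi)

  have "int (min_order r \<chi>) \<le> 2 * int (q * \<chi> + s)"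
    using upper1 by linarith
  moreover have "int (min_order r \<chi>) \<le> int a * int \<chi> * (int b + 1)"
    using upper2 by (metis of_nat_le_iff of_nat_mult of_nat_add of_nat_1)
  ultimately show ?thesis
    using lower unfolding floor quot by simp
qed

end
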